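(* Let $\gamma>0$. For almost every $x\in\Omega$ the following hold. Regarding $t\mapsto\varphi_\gamma(x,t)$ as a convex function on $[0,\infty)$, $$\partial_t\varphi_\gamma(x,t)=\begin{cases}(-\infty,\alpha],&t=0,\\ \{\alpha\},&0<t<\kappa(x),\\ [\alpha,\alpha(1+\gamma)],&t=\kappa(x),\\ \left\{\alpha\left(1+\gamma+\gamma\log\dfrac{t}{\kappa(x)}\right)\right\},&t>\kappa(x).\end{cases}$$ With $\varphi_\gamma^*(x,s)=\sup_{t\ge0}\{st-\varphi_\gamma(x,t)\}$ for $s\in\mathbb R$, $$\varphi_\gamma^*(x,s)=\begin{cases}0,&s\le\alpha,\\ \kappa(x)(s-\alpha),&\alpha<s\le\alpha(1+\gamma),\\ \alpha\gamma\kappa(x)\exp\!\left(\dfrac{s/\alpha-1-\gamma}{\gamma}\right),&s>\alpha(1+\gamma),\end{cases}$$ and this formula is continuous at $s=\alpha$ and $s=\alpha(1+\gamma)$. Moreover, $$\partial_s\varphi_\gamma^*(x,s)=\begin{cases}\{0\},&s<\alpha,\\ [0,\kappa(x)],&s=\alpha,\\ \{\kappa(x)\},&\alpha<s\le\alpha(1+\gamma),\\ \left\{\kappa(x)\exp\!\left(\dfrac{s/\alpha-1-\gamma}{\gamma}\right)\right\},&s>\alpha(1+\gamma).\end{cases}$$ Finally, for $\Phi_\gamma(x,z):=\varphi_\gamma(x,|z|)$, $z\in\mathbb R^N$, the vectorial subdifferential is radial: for $z\ne0$, $\partial_z\Phi_\gamma(x,z)=\partial_t\varphi_\gamma(x,|z|)\dfrac{z}{|z|}$,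 and hence $$\partial_z\Phi_\gamma(x,z)=\begin{cases}\left\{\alpha\dfrac{z}{|z|}\right\},&0<|z|<\kappa(x),\\ \left\{\lambda\dfrac{z}{|z|}:\lambda\in[\alpha,\alpha(1+\gamma)]\right\},&|z|=\kappa(x),\\ \left\{\alpha\left(1+\gamma+\gamma\log\dfrac{|z|}{\kappa(x)}\right)\dfrac{z}{|z|}\right\},&|z|>\kappa(x),\end{cases}$$ while at the origin $\partial_z\Phi_\gamma(x,0)=\{\xi\in\mathbb R^N:|\xi|\le\alpha\}$.
   Context: $\Omega\subset\mathbb R^N$ is a bounded Lipschitz domain, $\alpha>0$ is fixed, and $\kappa\in L^\infty(\Omega)$ is fixed with $0<\kappa_-\le\kappa(x)\le\kappa_+<\infty$ for a.e. $x\in\Omega$. With $\log^+r:=\max\{0,\log r\}$ for $r>0$ and $\log^+0:=0$, $$\varphi_\gamma(x,t):=\alpha t\Bigl(1+\gamma\log^+\frac{t}{\kappa(x)}\Bigr),\qquad t\ge0.$$ $\partial_t,\partial_s,\partial_z$ denote convex subdifferentials with respect to the indicated variable; for $t\mapsto\varphi_\gamma(x,t)$ the subgradient inequality is required over the domain $[0,\infty)$. *)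

theory Defs
  imports "HOL-Analysis.Analysis"
begin

text \<open>The boundary is required to be, near each of its points and in suitable orthonormal
  coordinates, the graph of a Lipschitz function. The unit vector \<open>e\<close> is the direction of the last
  coordinate, so that \<open>y \<bullet> e\<close> is that coordinate and \<open>y - (y \<bullet> e) *\<^sub>R e\<close> encodes the remaining
  ones as a point of the hyperplane orthogonal to \<open>e\<close>; \<open>\<Omega>\<close> lies locally on one side of the graph.\<close>

definition bounded_Lipschitz_domain :: "'a::euclidean_space set \<Rightarrow> bool" where
  "bounded_Lipschitz_domain \<Omega> \<longleftrightarrow>
     \<Omega> \<noteq> {} \<and> open \<Omega> \<and> connected \<Omega> \<and> bounded \<Omega> \<and>
     (\<forall>p \<in> frontier \<Omega>. \<exists>r e g L. 0 < r \<and> norm e = 1 \<and> L-lipschitz_on {v. v \<bullet> e = 0} g \<and>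
        \<Omega> \<inter> ball p r = {y \<in> ball p r. g (y - (y \<bullet> e) *\<^sub>R e) < y \<bullet> e})"

text \<open>Functions are representatives of their classes modulo null sets.\<close>

definition Linfty :: "'a::euclidean_space set \<Rightarrow> ('a \<Rightarrow> real) set" where
  "Linfty \<Omega> = {f \<in> borel_measurable (lebesgue_on \<Omega>). \<exists>C. AE x in lebesgue_on \<Omega>. \<bar>f x\<bar> \<le> C}"

definition log_plus :: "real \<Rightarrow> real" where
  "log_plus r = (if 0 < r then max 0 (ln r) else 0)"

text \<open>Only the values for \<open>t \<ge> 0\<close> are meaningful.\<close>

definition phi :: "real \<Rightarrow> ('a \<Rightarrow> real) \<Rightarrow> real \<Rightarrow> 'a \<Rightarrow> real \<Rightarrow> real" where
  "phi \<alpha> \<kappa> \<gamma> x t = \<alpha> * t * (1 + \<gamma> * log_plus (t / \<kappa> x))"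

text \<open>Valued in the extended reals, so that the supremum always has its intended meaning.\<close>

definition phi_conj :: "real \<Rightarrow> ('a \<Rightarrow> real) \<Rightarrow> real \<Rightarrow> 'a \<Rightarrow> real \<Rightarrow> ereal" where
  "phi_conj \<alpha> \<kappa> \<gamma> x s = (SUP t\<in>{0..}. ereal (s * t - phi \<alpha> \<kappa> \<gamma> x t))"

definition Phi :: "real \<Rightarrow> ('a \<Rightarrow> real) \<Rightarrow> real \<Rightarrow> 'a \<Rightarrow> 'b::real_normed_vector \<Rightarrow> real" where
  "Phi \<alpha> \<kappa> \<gamma> x z = phi \<alpha> \<kappa> \<gamma> x (norm z)"

text \<open>Convex subdifferential at \<open>x\<close> of a function considered on \<open>D\<close>, i.e. the subgradient inequality
  is required only for comparison points in \<open>D\<close>. It is empty where the function is not finite.\<close>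

definition subdifferential :: "'a::real_inner set \<Rightarrow> ('a \<Rightarrow> ereal) \<Rightarrow> 'a \<Rightarrow> 'a set" where
  "subdifferential D f x =
     {\<xi>. x \<in> D \<and> \<bar>f x\<bar> \<noteq> \<infinity> \<and> (\<forall>y \<in> D. f x + ereal (\<xi> \<bullet> (y - x)) \<le> f y)}"

end

theory Submission
  imports Defs
begin

text \<open>All claims about \<open>phi\<close> and its conjugate come from the Fenchel--Young inequality
  \<open>s t \<le> \<phi>(t) + F(s)\<close>, where \<open>F\<close> is the claimed conjugate, together with its equality cases. If every
  \<open>t\<close> and every \<open>s\<close> takes part in some equality, then each function is a supremum of affine functions
  coming from the other one: both are convex, they are conjugate, and the subgradients of one are
  the points where equality holds. In the vectorial case, comparing \<open>z\<close> with points of the same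
  norm forces a subgradient to be parallel to \<open>z\<close>, which reduces the problem to the half-line.\<close>

section \<open>Fenchel pairs on the real line\<close>

definition fenchel_pair :: "real set \<Rightarrow> real set \<Rightarrow> (real \<Rightarrow> real) \<Rightarrow> (real \<Rightarrow> real) \<Rightarrow> bool" where
  "fenchel_pair T S f g \<longleftrightarrow>
     (\<forall>t\<in>T. \<forall>s\<in>S. s * t \<le> f t + g s) \<and>
     (\<forall>t\<in>T. \<exists>s\<in>S. s * t = f t + g s) \<and>
     (\<forall>s\<in>S. \<exists>t\<in>T. s * t = f t + g s)"

lemma fenchel_pair_swap: "fenchel_pair T S f g \<Longrightarrow> fenchel_pair S T g f"
  unfolding fenchel_pair_def by (metis mult.commute add.commute)

text \<open>Each \<open>s\<close> in \<open>S\<close> gives an affine minorant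
  \<open>s * r - g s\<close> of \<open>f\<close> on \<open>T\<close>. The one touching
  \<open>f\<close> at the convex combination of \<open>x\<close> and \<open>y\<close> yields the
  convexity inequality there.\<close>

lemma fenchel_pair_convex_on:
  assumes "fenchel_pair T S f g" and "convex T"
  shows "convex_on T f"
proof (rule convex_onI)
  fix c x y :: real
  assume c: "0 < c" "c < 1" and x: "x \<in> T" and y: "y \<in> T"
  define t where "t = (1 - c) *\<^sub>R x + c *\<^sub>R y"
  have "t \<in> T"
    unfolding t_def using c x y by (intro convexD[OF assms(2)]) auto
  then obtain s where s: "s \<in> S" "s * t = f t + g s"
    using assms(1) by (auto simp: fenchel_pair_def)
  have "s * x \<le> f x + g s" "s * y \<le> f y + g s"
    using assms(1) s(1) x y by (auto simp: fenchel_pair_def)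
  then have "(1 - c) * (s * x) + c * (s * y) \<le> (1 - c) * (f x + g s) + c * (f y + g s)"
    using c by (intro add_mono mult_left_mono) auto
  also have "(1 - c) * (s * x) + c * (s * y) = s * t"
    by (simp add: t_def algebra_simps)
  finally show "f ((1 - c) *\<^sub>R x + c *\<^sub>R y) \<le> (1 - c) * f x + c * f y"
    unfolding t_def[symmetric] using s(2) by (simp add: distrib_left left_diff_distrib)
qed (fact assms(2))

lemma fenchel_pair_conjugate:
  assumes "fenchel_pair T S f g" and "s \<in> S"
  shows "(SUP t\<in>T. ereal (s * t - f t)) = ereal (g s)"
proof (rule antisym)
  show "(SUP t\<in>T. ereal (s * t - f t)) \<le> ereal (g s)"
    using assms by (intro SUP_least) (force simp: fenchel_pair_def)
  obtain t where t: "t \<in> T" "s * t = f t + g s"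
    using assms by (auto simp: fenchel_pair_def)
  then have "ereal (g s) = ereal (s * t - f t)" by simp
  also have "\<dots> \<le> (SUP t\<in>T. ereal (s * t - f t))"
    using t(1) by (intro SUP_upper)
  finally show "ereal (g s) \<le> (SUP t\<in>T. ereal (s * t - f t))" .
qed

lemma subdifferential_ereal:
  "subdifferential D (\<lambda>x. ereal (f x)) x = {\<xi>. x \<in> D \<and> (\<forall>y\<in>D. f x + \<xi> \<bullet> (y - x) \<le> f y)}"
  by (simp add: subdifferential_def)

lemma fenchel_pair_subdifferential:
  assumes fg: "fenchel_pair T S f g" and t: "t \<in> T" and s: "s \<in> S"
  shows "s \<in> subdifferential T (\<lambda>t. ereal (f t)) t \<longleftrightarrow> s * t = f t + g s"
proof
  assume sub: "s \<in> subdifferential T (\<lambda>t. ereal (f t)) t"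
  \<comment> \<open>At a point \<open>u\<close> where \<open>s\<close> attains equality,
    \<open>f u\<close> can be replaced by \<open>s * u - g s\<close>. The subgradient inequality
    tested there becomes the reverse of Fenchel--Young at \<open>t\<close>.\<close>
  obtain u where u: "u \<in> T" "s * u = f u + g s"
    using fg s by (auto simp: fenchel_pair_def)
  have "f t + s * (u - t) \<le> f u"
    using sub u(1) by (auto simp: subdifferential_ereal)
  then have "f t + g s \<le> s * t"
    using u(2) by (simp add: algebra_simps)
  moreover have "s * t \<le> f t + g s"
    using fg s t by (auto simp: fenchel_pair_def)
  ultimately show "s * t = f t + g s" by simp
next
  assume eq: "s * t = f t + g s"
  have "f t + s * (y - t) \<le> f y" if "y \<in> T" for y
  proof -
    have "s * y \<le> f y + g s" using fg s that by (auto simp: fenchel_pair_def)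
    then show ?thesis using eq by (simp add: algebra_simps)
  qed
  then show "s \<in> subdifferential T (\<lambda>t. ereal (f t)) t"
    using t by (simp add: subdifferential_ereal)
qed

section \<open>Subgradients of radial functions\<close>

text \<open>Turning \<open>z\<close> into the direction of \<open>\<xi>\<close> keeps its norm, so
  the subgradient inequality forces equality in Cauchy--Schwarz. Comparison points on the ray
  spanned by that direction then give the inequality on the half-line.\<close>

lemma norm_subgradient_radial:
  fixes f :: "real \<Rightarrow> real" and z :: "'a::real_inner"
  assumes "\<xi> \<in> subdifferential UNIV (\<lambda>z. ereal (f (norm z))) z" and "\<xi> \<noteq> 0 \<or> z \<noteq> 0"
  shows "norm \<xi> *\<^sub>R z = norm z *\<^sub>R \<xi>"
    and "norm \<xi> \<in> subdifferential {0..} (\<lambda>t. ereal (f t)) (norm z)"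
proof -
  have sub: "f (norm z) + \<xi> \<bullet> (y - z) \<le> f (norm y)" for y
    using assms(1) by (auto simp: subdifferential_ereal)
  \<comment> \<open>A unit vector with \<open>\<xi> = norm \<xi> *\<^sub>R e\<close> is wanted also
    for \<open>\<xi> = 0\<close>, where the direction of \<open>z\<close> serves; the disjunction in
    the assumptions guarantees that one of the two directions exists.\<close>
  define e where "e = (if \<xi> = 0 then z /\<^sub>R norm z else \<xi> /\<^sub>R norm \<xi>)"
  have ne: "norm e = 1" and xe: "\<xi> = norm \<xi> *\<^sub>R e"
    using assms(2) by (auto simp: e_def)
  have ie: "\<xi> \<bullet> e = norm \<xi>"
    using ne by (subst xe) (simp add: dot_square_norm)
  have "f (norm z) + \<xi> \<bullet> (norm z *\<^sub>R e - z) \<le> f (norm z)"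
    using sub[of "norm z *\<^sub>R e"] ne by simp
  then have "norm \<xi> * norm z \<le> \<xi> \<bullet> z"
    by (simp add: inner_diff_right ie mult.commute)
  then have inz: "\<xi> \<bullet> z = norm \<xi> * norm z"
    using norm_cauchy_schwarz[of \<xi> z] by linarith
  then show "norm \<xi> *\<^sub>R z = norm z *\<^sub>R \<xi>"
    by (simp add: norm_cauchy_schwarz_eq)
  have "f (norm z) + norm \<xi> * (t - norm z) \<le> f t" if "0 \<le> t" for t
    using sub[of "t *\<^sub>R e"] that ne by (simp add: inner_diff_right ie inz algebra_simps)
  then show "norm \<xi> \<in> subdifferential {0..} (\<lambda>t. ereal (f t)) (norm z)"
    by (simp add: subdifferential_ereal mult.commute)
qed

text \<open>One inclusion is the preceding lemma. For the other, Cauchy--Schwarz bounds the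
  component of \<open>y\<close> along \<open>z\<close> by \<open>norm y\<close>, and
  \<open>0 \<le> l\<close> allows this bound to be multiplied by the slope \<open>l\<close>.\<close>

lemma subdifferential_radial_nonzero:
  fixes f :: "real \<Rightarrow> real" and z :: "'a::real_inner"
  assumes z: "z \<noteq> 0"
    and nonneg: "\<And>l. l \<in> subdifferential {0..} (\<lambda>t. ereal (f t)) (norm z) \<Longrightarrow> 0 \<le> l"
  shows "subdifferential UNIV (\<lambda>z. ereal (f (norm z))) z =
    (\<lambda>l. l *\<^sub>R (z /\<^sub>R norm z)) ` subdifferential {0..} (\<lambda>t. ereal (f t)) (norm z)"
proof (intro equalityI subsetI)
  fix \<xi> assume sub: "\<xi> \<in> subdifferential UNIV (\<lambda>z. ereal (f (norm z))) z"
  have "\<xi> = (norm z *\<^sub>R \<xi>) /\<^sub>R norm z"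
    using z by simp
  also have "\<dots> = norm \<xi> *\<^sub>R (z /\<^sub>R norm z)"
    using norm_subgradient_radial(1)[OF sub disjI2[OF z]] by (metis scaleR_left_commute)
  finally show "\<xi> \<in> (\<lambda>l. l *\<^sub>R (z /\<^sub>R norm z)) ` subdifferential {0..} (\<lambda>t. ereal (f t)) (norm z)"
    using norm_subgradient_radial(2)[OF sub disjI2[OF z]] by blast
next
  fix \<xi> assume "\<xi> \<in> (\<lambda>l. l *\<^sub>R (z /\<^sub>R norm z)) ` subdifferential {0..} (\<lambda>t. ereal (f t)) (norm z)"
  then obtain l where l: "l \<in> subdifferential {0..} (\<lambda>t. ereal (f t)) (norm z)"
    and xi: "\<xi> = l *\<^sub>R (z /\<^sub>R norm z)" by blast
  have "f (norm z) + \<xi> \<bullet> (y - z) \<le> f (norm y)" for y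
  proof -
    have "\<xi> \<bullet> (y - z) = l * ((z /\<^sub>R norm z) \<bullet> y - norm z)"
      using z by (simp add: xi inner_diff_right dot_square_norm power2_eq_square field_simps)
    also have "\<dots> \<le> l * (norm y - norm z)"
      using norm_cauchy_schwarz[of "z /\<^sub>R norm z" y] z nonneg[OF l]
      by (intro mult_left_mono) auto
    finally show ?thesis
      using l by (auto simp: subdifferential_ereal mult.commute dest!: bspec[of _ _ "norm y"])
  qed
  then show "\<xi> \<in> subdifferential UNIV (\<lambda>z. ereal (f (norm z))) z"
    by (simp add: subdifferential_ereal)
qed

text \<open>Only the nonnegative slopes in \<open>{..a}\<close> can be lengths of vectors. The
  vector \<open>\<xi> = 0\<close> has no direction to compare along at the origin and is covered by
  \<open>0 \<le> a\<close> instead.\<close>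

lemma subdifferential_radial_zero:
  fixes f :: "real \<Rightarrow> real"
  assumes D: "subdifferential {0..} (\<lambda>t. ereal (f t)) 0 = {..a}" and "0 \<le> a"
  shows "subdifferential UNIV (\<lambda>z :: 'a::real_inner. ereal (f (norm z))) 0 = {\<xi>. norm \<xi> \<le> a}"
proof (intro equalityI subsetI)
  fix \<xi> :: 'a assume "\<xi> \<in> subdifferential UNIV (\<lambda>z. ereal (f (norm z))) 0"
  from norm_subgradient_radial(2)[OF this] D \<open>0 \<le> a\<close>
  show "\<xi> \<in> {\<xi>. norm \<xi> \<le> a}" by (cases "\<xi> = 0") auto
next
  fix \<xi> :: 'a assume "\<xi> \<in> {\<xi>. norm \<xi> \<le> a}"
  then have "norm \<xi> \<in> subdifferential {0..} (\<lambda>t. ereal (f t)) 0" using D by simp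
  then have "f 0 + norm \<xi> * norm y \<le> f (norm y)" for y :: 'a
    by (auto simp: subdifferential_ereal mult.commute dest!: bspec[of _ _ "norm y"])
  then have "f 0 + \<xi> \<bullet> y \<le> f (norm y)" for y
    using norm_cauchy_schwarz[of \<xi> y] by (meson add_left_mono order_trans)
  then show "\<xi> \<in> subdifferential UNIV (\<lambda>z. ereal (f (norm z))) 0"
    by (simp add: subdifferential_ereal)
qed

section \<open>The closed formulas and the equality cases of Fenchel--Young\<close>

text \<open>The candidate for the conjugate, real-valued and with the number \<open>k\<close> in
  place of \<open>\<kappa> x\<close>, since everything happens at a fixed point
  \<open>x\<close>.\<close>

definition phi_conj_fun :: "real \<Rightarrow> real \<Rightarrow> real \<Rightarrow> real \<Rightarrow> real" where
  "phi_conj_fun \<alpha> k \<gamma> s =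
     (if s \<le> \<alpha> then 0
      else if s \<le> \<alpha> * (1 + \<gamma>) then k * (s - \<alpha>)
      else \<alpha> * \<gamma> * k * exp ((s / \<alpha> - 1 - \<gamma>) / \<gamma>))"

definition phi_subgradients :: "real \<Rightarrow> real \<Rightarrow> real \<Rightarrow> real \<Rightarrow> real set" where
  "phi_subgradients \<alpha> k \<gamma> t =
     (if t = 0 then {..\<alpha>}
      else if t < k then {\<alpha>}
      else if t = k then {\<alpha>..\<alpha> * (1 + \<gamma>)}
      else {\<alpha> * (1 + \<gamma> + \<gamma> * ln (t / k))})"

definition phi_conj_subgradients :: "real \<Rightarrow> real \<Rightarrow> real \<Rightarrow> real \<Rightarrow> real set" where
  "phi_conj_subgradients \<alpha> k \<gamma> s =
     (if s < \<alpha> then {0}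
      else if s = \<alpha> then {0..k}
      else if s \<le> \<alpha> * (1 + \<gamma>) then {k}
      else {k * exp ((s / \<alpha> - 1 - \<gamma>) / \<gamma>)})"

lemma phi_below:
  assumes "0 < \<kappa> x" and "t \<le> \<kappa> x"
  shows "phi \<alpha> \<kappa> \<gamma> x t = \<alpha> * t"
proof -
  have "t / \<kappa> x \<le> 1" using assms by simp
  then have "log_plus (t / \<kappa> x) = 0" by (simp add: log_plus_def)
  then show ?thesis by (simp add: phi_def)
qed

lemma phi_above:
  assumes "0 < \<kappa> x" and "\<kappa> x \<le> t"
  shows "phi \<alpha> \<kappa> \<gamma> x t = \<alpha> * t * (1 + \<gamma> * ln (t / \<kappa> x))"
  using assms by (simp add: phi_def log_plus_def)

text \<open>Strict convexity of \<open>exp\<close>: the left side is the tangent at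
  \<open>v\<close>, evaluated at \<open>u\<close>. Strictness comes from \<open>ln y = y - 1\<close>
  holding only at \<open>y = 1\<close>.\<close>

lemma exp_tangent_less: "u \<noteq> v \<Longrightarrow> (1 + u - v) * exp v < exp u" for u v :: real
proof -
  assume "u \<noteq> v"
  moreover have "1 + (u - v) \<le> exp (u - v)" by (rule exp_ge_add_one_self)
  ultimately have "1 + (u - v) < exp (u - v)"
    using ln_eq_minus_one[of "exp (u - v)"] by (intro order.not_eq_order_implies_strict) auto
  then have "(1 + (u - v)) * exp v < exp (u - v) * exp v" by simp
  then show "(1 + u - v) * exp v < exp u"
    by (simp add: add_diff_eq flip: exp_add)
qed

text \<open>Writing \<open>s = \<alpha> (1 + \<gamma> + \<gamma> u)\<close> and \<open>t = k exp v\<close> turns the case of large \<open>s\<close> and \<open>t\<close> into the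
  tangent inequality \<open>(1 + u - v) exp v \<le> exp u\<close>.\<close>

lemma phi_fenchel_young:
  assumes pos: "0 < \<alpha>" "0 < \<gamma>" "0 < \<kappa> x" and t0: "0 \<le> t"
  shows "s * t \<le> phi \<alpha> \<kappa> \<gamma> x t + phi_conj_fun \<alpha> (\<kappa> x) \<gamma> s"
    and "s * t = phi \<alpha> \<kappa> \<gamma> x t + phi_conj_fun \<alpha> (\<kappa> x) \<gamma> s \<longleftrightarrow>
      s \<in> phi_subgradients \<alpha> (\<kappa> x) \<gamma> t"
proof -
  define k where "k = \<kappa> x"
  \<comment> \<open>The Fenchel--Young gap: both claims say that \<open>d\<close> is nonnegative and
    vanishes exactly on the claimed graph.\<close>
  define d where "d = phi \<alpha> \<kappa> \<gamma> x t + phi_conj_fun \<alpha> k \<gamma> s - s * t"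
  define u where "u = (s / \<alpha> - 1 - \<gamma>) / \<gamma>"
  have k: "0 < k" using pos by (simp add: k_def)
  have s_u: "s = \<alpha> * (1 + \<gamma> + \<gamma> * u)" using pos by (simp add: u_def)
  have ag: "0 < \<alpha> * \<gamma>" using pos by simp
  then have lin: "\<alpha> < \<alpha> * (1 + \<gamma>)" by (simp add: algebra_simps)
  \<comment> \<open>The cases follow the kinks of the two formulas. In the third and fourth,
    \<open>t\<close> and \<open>s\<close> lie on incompatible branches, and the gap is strictly
    positive.\<close>
  consider "t \<le> k" "s \<le> \<alpha>" | "t \<le> k" "\<alpha> < s" "s \<le> \<alpha> * (1 + \<gamma>)" | "t \<le> k" "\<alpha> * (1 + \<gamma>) < s"
    | "k < t" "s \<le> \<alpha> * (1 + \<gamma>)" | "k < t" "\<alpha> * (1 + \<gamma>) < s"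
    by linarith
  then have "0 \<le> d \<and> (d = 0 \<longleftrightarrow> s \<in> phi_subgradients \<alpha> k \<gamma> t)"
  proof cases
    case 1
    then have "d = (\<alpha> - s) * t"
      using pos by (simp add: d_def phi_below k_def phi_conj_fun_def algebra_simps)
    then show ?thesis
      using 1 t0 lin k by (auto simp: phi_subgradients_def)
  next
    case 2
    then have "d = (s - \<alpha>) * (k - t)"
      using pos by (simp add: d_def phi_below k_def phi_conj_fun_def algebra_simps)
    then show ?thesis
      using 2 k by (auto simp: phi_subgradients_def)
  next
    case 3
    then have u: "0 < u" using pos by (simp add: s_u zero_less_mult_iff)
    have ph: "phi \<alpha> \<kappa> \<gamma> x t = \<alpha> * t"
      using 3 pos by (simp add: phi_below k_def)
    have F: "phi_conj_fun \<alpha> k \<gamma> s = \<alpha> * \<gamma> * k * exp u"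
      using 3 lin by (simp add: phi_conj_fun_def u_def)
    have d: "d = \<alpha> * \<gamma> * (k * exp u - (1 + u) * t)"
      unfolding d_def ph F by (simp add: s_u algebra_simps)
    \<comment> \<open>The bracket in \<open>d\<close> is smallest at \<open>t = k\<close>, where its
      positivity is the tangent inequality at 0.\<close>
    have "(1 + u) * t \<le> (1 + u) * k"
      using 3 u by simp
    also have "\<dots> < exp u * k"
      using exp_tangent_less[of u 0] u k by simp
    finally have "0 < d"
      unfolding d using pos by (intro mult_pos_pos) (simp_all add: mult.commute)
    then show ?thesis
      using 3 lin k by (auto simp: phi_subgradients_def)
  next
    case 4
    define v where "v = ln (t / k)"
    have v: "0 < v" "t = k * exp v" using 4 k t0 by (auto simp: v_def)
    have gv: "\<alpha> * (1 + \<gamma>) < \<alpha> * (1 + \<gamma> + \<gamma> * v)"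
      using v pos by (intro mult_strict_left_mono) auto
    have ph: "phi \<alpha> \<kappa> \<gamma> x t = \<alpha> * t * (1 + \<gamma> * v)"
      using 4 pos by (simp add: phi_above v_def k_def)
    have "0 < d"
    proof (cases "s \<le> \<alpha>")
      case True
      then have "d = (\<alpha> - s) * t + \<alpha> * \<gamma> * t * v"
        using ph by (simp add: d_def phi_conj_fun_def algebra_simps)
      moreover have "0 < \<alpha> * \<gamma> * t * v"
        using 4 k v ag by simp
      moreover have "0 \<le> (\<alpha> - s) * t"
        using True t0 by simp
      ultimately show ?thesis by linarith
    next
      case False
      then have "d = \<alpha> * \<gamma> * t * v - (s - \<alpha>) * (t - k)"
        using ph 4 by (simp add: d_def phi_conj_fun_def algebra_simps)
      moreover have "(s - \<alpha>) * (t - k) \<le> \<alpha> * \<gamma> * (t - k)"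
        using 4 by (intro mult_right_mono) (auto simp: algebra_simps)
      \<comment> \<open>The tangent of \<open>exp\<close> at \<open>v\<close>, evaluated at 0 and
        scaled by \<open>k\<close>, reads \<open>t - t * v < k\<close>.\<close>
      moreover have "t - k < t * v"
        using mult_strict_left_mono[OF exp_tangent_less[of 0 v] k] v by (simp add: algebra_simps)
      then have "\<alpha> * \<gamma> * (t - k) < \<alpha> * \<gamma> * (t * v)"
        using ag by (rule mult_strict_left_mono)
      ultimately show ?thesis by (simp add: mult.assoc)
    qed
    then show ?thesis
      using 4 gv k by (auto simp: phi_subgradients_def simp flip: v_def)
  next
    case 5
    define v where "v = ln (t / k)"
    have v: "t = k * exp v" using 5 k t0 by (auto simp: v_def)
    have ph: "phi \<alpha> \<kappa> \<gamma> x t = \<alpha> * t * (1 + \<gamma> * v)"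
      using 5 pos by (simp add: phi_above v_def k_def)
    have F: "phi_conj_fun \<alpha> k \<gamma> s = \<alpha> * \<gamma> * k * exp u"
      using 5 lin by (simp add: phi_conj_fun_def u_def)
    \<comment> \<open>The gap is a positive multiple of the distance between \<open>exp u\<close>
      and its tangent at \<open>v\<close>, hence zero only for \<open>u = v\<close>.\<close>
    have d: "d = \<alpha> * \<gamma> * k * (exp u - (1 + u - v) * exp v)"
      unfolding d_def ph F by (simp add: s_u v algebra_simps)
    have "s \<in> phi_subgradients \<alpha> k \<gamma> t \<longleftrightarrow> u = v"
      using 5 k pos by (simp add: phi_subgradients_def s_u flip: v_def)
    moreover have "0 \<le> d \<and> (d = 0 \<longleftrightarrow> u = v)"
    proof (cases "u = v")
      case False
      have "0 < d"
        unfolding d using ag k exp_tangent_less[OF False] by simp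
      then show ?thesis using False by simp
    qed (simp add: d)
    ultimately show ?thesis by simp
  qed
  then show "s * t \<le> phi \<alpha> \<kappa> \<gamma> x t + phi_conj_fun \<alpha> (\<kappa> x) \<gamma> s"
    and "s * t = phi \<alpha> \<kappa> \<gamma> x t + phi_conj_fun \<alpha> (\<kappa> x) \<gamma> s \<longleftrightarrow>
      s \<in> phi_subgradients \<alpha> (\<kappa> x) \<gamma> t"
    by (auto simp: d_def k_def)
qed

text \<open>The two set-valued formulas are inverse relations on the half-line. The conjunct
  \<open>0 \<le> t\<close> matters because \<open>phi_subgradients\<close> takes the value
  \<open>{\<alpha>}\<close> at negative \<open>t\<close>.\<close>

lemma phi_conj_subgradients_iff:
  assumes "0 < \<alpha>" "0 < \<gamma>" "0 < k"
  shows "t \<in> phi_conj_subgradients \<alpha> k \<gamma> s \<longleftrightarrow> 0 \<le> t \<and> s \<in> phi_subgradients \<alpha> k \<gamma> t"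
proof -
  have lin: "\<alpha> < \<alpha> * (1 + \<gamma>)" using assms by simp
  define u where "u = (s / \<alpha> - 1 - \<gamma>) / \<gamma>"
  have s_u: "s = \<alpha> * (1 + \<gamma> + \<gamma> * u)" using assms by (simp add: u_def)
  have u: "\<alpha> * (1 + \<gamma>) < s \<longleftrightarrow> 0 < u"
    using assms by (simp add: s_u zero_less_mult_iff)
  \<comment> \<open>Beyond \<open>k\<close> the relation is \<open>u = ln (t / k)\<close>, which can
    be solved for \<open>t\<close>.\<close>
  have above: "s \<in> phi_subgradients \<alpha> k \<gamma> t \<longleftrightarrow> t = k * exp u" if "k < t"
  proof -
    have "s \<in> phi_subgradients \<alpha> k \<gamma> t \<longleftrightarrow> u = ln (t / k)"
      using that assms by (simp add: phi_subgradients_def s_u)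
    also have "\<dots> \<longleftrightarrow> t = k * exp u"
      using that assms by (auto simp: field_simps)
    finally show ?thesis .
  qed
  consider "k < t" "0 < u" | "k < t" "\<not> 0 < u" | "t \<le> k" by linarith
  then show ?thesis
  proof cases
    case 1
    then have "\<alpha> < s" "\<alpha> * (1 + \<gamma>) < s" using u lin by auto
    then show ?thesis
      using 1 above assms by (simp add: phi_conj_subgradients_def flip: u_def)
  next
    case 2
    then have "k * exp u \<le> k" using assms by simp
    with 2 have "s \<notin> phi_subgradients \<alpha> k \<gamma> t"
      using above by simp
    moreover have "t \<notin> phi_conj_subgradients \<alpha> k \<gamma> s"
      using 2 u assms by (simp add: phi_conj_subgradients_def)
    ultimately show ?thesis by simp
  next
    case 3
    \<comment> \<open>For large \<open>s\<close> the only candidate \<open>k * exp u\<close> exceeds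
      \<open>k\<close>, so no \<open>t \<le> k\<close> belongs to it; the other branches involve
      only constants.\<close>
    have "t \<noteq> k * exp u" if "\<alpha> * (1 + \<gamma>) < s"
    proof -
      have "k < k * exp u" using that u assms by simp
      with 3 show ?thesis by simp
    qed
    then show ?thesis
      using 3 lin assms
      by (auto simp: phi_conj_subgradients_def phi_subgradients_def u_def[symmetric] split: if_splits)
  qed
qed

section \<open>Subdifferentials and conjugate of \<open>phi\<close>\<close>

text \<open>By the equality cases, attainment means that the claimed subgradient sets are nonempty
  in both directions. A partner of \<open>s\<close> comes from the inverse relation.\<close>

lemma phi_fenchel_pair:
  assumes "0 < \<alpha>" "0 < \<gamma>" "0 < \<kappa> x"
  shows "fenchel_pair {0..} UNIV (phi \<alpha> \<kappa> \<gamma> x) (phi_conj_fun \<alpha> (\<kappa> x) \<gamma>)"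
proof -
  have "\<exists>s. s \<in> phi_subgradients \<alpha> (\<kappa> x) \<gamma> t" for t
    using assms unfolding phi_subgradients_def by (auto intro: exI[of _ \<alpha>])
  moreover have "\<exists>t\<ge>0. s \<in> phi_subgradients \<alpha> (\<kappa> x) \<gamma> t" for s
  proof -
    have "\<exists>t. t \<in> phi_conj_subgradients \<alpha> (\<kappa> x) \<gamma> s"
      using assms unfolding phi_conj_subgradients_def by (auto intro: exI[of _ 0])
    then show ?thesis
      by (simp add: phi_conj_subgradients_iff assms)
  qed
  ultimately show ?thesis
    unfolding fenchel_pair_def
    using phi_fenchel_young[where \<kappa> = \<kappa> and x = x, OF assms] by (meson UNIV_I atLeast_iff)
qed

lemma phi_subdifferential:
  assumes "0 < \<alpha>" "0 < \<gamma>" "0 < \<kappa> x" "0 \<le> t"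
  shows "subdifferential {0..} (\<lambda>t. ereal (phi \<alpha> \<kappa> \<gamma> x t)) t = phi_subgradients \<alpha> (\<kappa> x) \<gamma> t"
proof (rule set_eqI)
  fix s
  have "s \<in> subdifferential {0..} (\<lambda>t. ereal (phi \<alpha> \<kappa> \<gamma> x t)) t \<longleftrightarrow>
      s * t = phi \<alpha> \<kappa> \<gamma> x t + phi_conj_fun \<alpha> (\<kappa> x) \<gamma> s"
    using phi_fenchel_pair[where \<kappa> = \<kappa> and x = x, OF assms(1-3)]
    by (rule fenchel_pair_subdifferential) (use assms(4) in simp_all)
  also have "\<dots> \<longleftrightarrow> s \<in> phi_subgradients \<alpha> (\<kappa> x) \<gamma> t"
    using assms by (rule phi_fenchel_young(2))
  finally show "s \<in> subdifferential {0..} (\<lambda>t. ereal (phi \<alpha> \<kappa> \<gamma> x t)) t \<longleftrightarrow>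
      s \<in> phi_subgradients \<alpha> (\<kappa> x) \<gamma> t" .
qed

lemma phi_conj_eq:
  assumes "0 < \<alpha>" "0 < \<gamma>" "0 < \<kappa> x"
  shows "phi_conj \<alpha> \<kappa> \<gamma> x s = ereal (phi_conj_fun \<alpha> (\<kappa> x) \<gamma> s)"
  unfolding phi_conj_def
  by (rule fenchel_pair_conjugate[OF phi_fenchel_pair[where \<kappa> = \<kappa> and x = x, OF assms] UNIV_I])

lemma phi_conj_fun_nonneg: "0 < \<alpha> \<Longrightarrow> 0 < \<gamma> \<Longrightarrow> 0 < k \<Longrightarrow> 0 \<le> phi_conj_fun \<alpha> k \<gamma> s"
  by (simp add: phi_conj_fun_def)

text \<open>Swapping the pair settles slopes \<open>t \<ge> 0\<close>. Negative slopes lie outside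
  the domain of the pair and are excluded by hand.\<close>

lemma phi_conj_subdifferential:
  assumes pos: "0 < \<alpha>" "0 < \<gamma>" "0 < \<kappa> x"
  shows "subdifferential UNIV (phi_conj \<alpha> \<kappa> \<gamma> x) s = phi_conj_subgradients \<alpha> (\<kappa> x) \<gamma> s"
proof -
  let ?F = "phi_conj_fun \<alpha> (\<kappa> x) \<gamma>"
  have "phi_conj \<alpha> \<kappa> \<gamma> x = (\<lambda>s. ereal (?F s))"
    by (rule ext) (rule phi_conj_eq[where \<kappa> = \<kappa> and x = x, OF pos])
  moreover have "t \<in> subdifferential UNIV (\<lambda>s. ereal (?F s)) s \<longleftrightarrow> t \<in> phi_conj_subgradients \<alpha> (\<kappa> x) \<gamma> s" for t
  proof (cases "0 \<le> t")
    case True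
    have "t \<in> subdifferential UNIV (\<lambda>s. ereal (?F s)) s \<longleftrightarrow> t * s = ?F s + phi \<alpha> \<kappa> \<gamma> x t"
      using fenchel_pair_swap[OF phi_fenchel_pair[where \<kappa> = \<kappa> and x = x, OF pos]]
      by (rule fenchel_pair_subdifferential) (use True in simp_all)
    also have "\<dots> \<longleftrightarrow> s * t = phi \<alpha> \<kappa> \<gamma> x t + ?F s"
      by (simp only: mult.commute add.commute)
    also have "\<dots> \<longleftrightarrow> s \<in> phi_subgradients \<alpha> (\<kappa> x) \<gamma> t"
      using pos True by (rule phi_fenchel_young(2))
    finally show ?thesis
      using True pos by (simp add: phi_conj_subgradients_iff)
  next
    case False
    \<comment> \<open>A point to the left of both \<open>s\<close> and \<alpha>: there the conjugate
      vanishes, while a line of negative slope through its nonnegative value at \<open>s\<close> is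
      positive.\<close>
    define y where "y = min s \<alpha> - 1"
    have "?F y = 0" by (simp add: y_def phi_conj_fun_def)
    moreover have "0 < t * (y - s)"
      using False by (intro mult_neg_neg) (auto simp: y_def)
    ultimately have "\<not> ?F s + t * (y - s) \<le> ?F y"
      using phi_conj_fun_nonneg[of \<alpha> \<gamma> "\<kappa> x" s, OF pos] by linarith
    then show ?thesis
      using False pos by (auto simp: subdifferential_ereal phi_conj_subgradients_iff)
  qed
  ultimately show ?thesis by (intro set_eqI) simp
qed

text \<open>A finite convex function on the whole line is continuous, so the branches need not be
  glued. Convexity comes from the swapped pair, with a constant function in place of
  \<open>\<kappa>\<close>.\<close>

lemma isCont_phi_conj_fun:
  assumes "0 < \<alpha>" "0 < \<gamma>" "0 < k"
  shows "isCont (phi_conj_fun \<alpha> k \<gamma>) s"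
proof -
  have "convex_on UNIV (phi_conj_fun \<alpha> k \<gamma>)"
    using fenchel_pair_convex_on[OF fenchel_pair_swap[OF phi_fenchel_pair[of \<alpha> \<gamma> "\<lambda>_. k"]]] assms
    by simp
  then have "continuous_on UNIV (phi_conj_fun \<alpha> k \<gamma>)"
    by (intro convex_on_continuous) auto
  then show ?thesis by (simp add: continuous_on_eq_continuous_at)
qed

section \<open>The statement at almost every point\<close>

theorem lemma4p6:
  fixes \<Omega> :: "(real ^ 'n) set" and \<kappa> :: "real ^ 'n \<Rightarrow> real"
    and \<alpha> \<gamma> \<kappa>_minus \<kappa>_plus :: real
  assumes "bounded_Lipschitz_domain \<Omega>"
    and "0 < \<alpha>"
    and "\<kappa> \<in> Linfty \<Omega>"
    and "0 < \<kappa>_minus"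
    and "AE x in lebesgue_on \<Omega>. \<kappa>_minus \<le> \<kappa> x \<and> \<kappa> x \<le> \<kappa>_plus"
    and "0 < \<gamma>"
  shows "AE x in lebesgue_on \<Omega>.
    convex_on {0..} (phi \<alpha> \<kappa> \<gamma> x) \<and>
    (\<forall>t\<ge>0. subdifferential {0..} (\<lambda>t. ereal (phi \<alpha> \<kappa> \<gamma> x t)) t =
       (if t = 0 then {..\<alpha>}
        else if t < \<kappa> x then {\<alpha>}
        else if t = \<kappa> x then {\<alpha>..\<alpha> * (1 + \<gamma>)}
        else {\<alpha> * (1 + \<gamma> + \<gamma> * ln (t / \<kappa> x))})) \<and>
    (let F = (\<lambda>s. if s \<le> \<alpha> then 0
                  else if s \<le> \<alpha> * (1 + \<gamma>) then \<kappa> x * (s - \<alpha>)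
                  else \<alpha> * \<gamma> * \<kappa> x * exp ((s / \<alpha> - 1 - \<gamma>) / \<gamma>))
     in (\<forall>s. phi_conj \<alpha> \<kappa> \<gamma> x s = ereal (F s)) \<and>
        isCont F \<alpha> \<and> isCont F (\<alpha> * (1 + \<gamma>))) \<and>
    (\<forall>s. subdifferential UNIV (phi_conj \<alpha> \<kappa> \<gamma> x) s =
       (if s < \<alpha> then {0}
        else if s = \<alpha> then {0..\<kappa> x}
        else if s \<le> \<alpha> * (1 + \<gamma>) then {\<kappa> x}
        else {\<kappa> x * exp ((s / \<alpha> - 1 - \<gamma>) / \<gamma>)})) \<and>
    (\<forall>z :: real ^ 'n. z \<noteq> 0 \<longrightarrow>
       subdifferential UNIV (\<lambda>z :: real ^ 'n. ereal (Phi \<alpha> \<kappa> \<gamma> x z)) z =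
         (\<lambda>l. l *\<^sub>R (z /\<^sub>R norm z)) `
           subdifferential {0..} (\<lambda>t. ereal (phi \<alpha> \<kappa> \<gamma> x t)) (norm z)) \<and>
    (\<forall>z :: real ^ 'n. z \<noteq> 0 \<longrightarrow>
       subdifferential UNIV (\<lambda>z :: real ^ 'n. ereal (Phi \<alpha> \<kappa> \<gamma> x z)) z =
         (if norm z < \<kappa> x then {\<alpha> *\<^sub>R (z /\<^sub>R norm z)}
          else if norm z = \<kappa> x then {l *\<^sub>R (z /\<^sub>R norm z) | l. l \<in> {\<alpha>..\<alpha> * (1 + \<gamma>)}}
          else {(\<alpha> * (1 + \<gamma> + \<gamma> * ln (norm z / \<kappa> x))) *\<^sub>R (z /\<^sub>R norm z)})) \<and>
    subdifferential UNIV (\<lambda>z :: real ^ 'n. ereal (Phi \<alpha> \<kappa> \<gamma> x z)) 0 = {\<xi>. norm \<xi> \<le> \<alpha>}"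
  using assms(5)
proof eventually_elim
  case (elim x)
  \<comment> \<open>The positive lower bound makes \<open>\<kappa> x\<close> positive at almost
    every \<open>x\<close>; from here on \<open>x\<close> is fixed.\<close>
  with assms have pos: "0 < \<alpha>" "0 < \<gamma>" "0 < \<kappa> x" by auto
  let ?d = "\<lambda>t. subdifferential {0..} (\<lambda>t. ereal (phi \<alpha> \<kappa> \<gamma> x t)) t"
  let ?D = "\<lambda>z::real^'n. subdifferential UNIV (\<lambda>z. ereal (Phi \<alpha> \<kappa> \<gamma> x z)) z"
  have d: "?d t = phi_subgradients \<alpha> (\<kappa> x) \<gamma> t" if "0 \<le> t" for t
    using pos that by (rule phi_subdifferential)
  \<comment> \<open>Since \<open>norm z\<close> is positive, the unbounded branch
    \<open>{..\<alpha>}\<close> does not occur, and all other slopes are positive.\<close>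
  have nonneg: "0 \<le> l" if "l \<in> ?d (norm z)" "z \<noteq> 0" for l and z :: "real^'n"
    using that pos by (auto simp: d phi_subgradients_def split: if_splits)
  have radial: "?D z = (\<lambda>l. l *\<^sub>R (z /\<^sub>R norm z)) ` ?d (norm z)" if "z \<noteq> 0" for z
    unfolding Phi_def using that nonneg[OF _ that] by (rule subdifferential_radial_nonzero)
  have F: "(\<lambda>s. if s \<le> \<alpha> then 0
                else if s \<le> \<alpha> * (1 + \<gamma>) then \<kappa> x * (s - \<alpha>)
                else \<alpha> * \<gamma> * \<kappa> x * exp ((s / \<alpha> - 1 - \<gamma>) / \<gamma>)) = phi_conj_fun \<alpha> (\<kappa> x) \<gamma>"
    by (simp add: phi_conj_fun_def fun_eq_iff)
  have conv: "convex_on {0..} (phi \<alpha> \<kappa> \<gamma> x)"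
    using phi_fenchel_pair[where \<kappa> = \<kappa> and x = x, OF pos] by (rule fenchel_pair_convex_on) simp
  have cases: "?D z =
         (if norm z < \<kappa> x then {\<alpha> *\<^sub>R (z /\<^sub>R norm z)}
          else if norm z = \<kappa> x then {l *\<^sub>R (z /\<^sub>R norm z) | l. l \<in> {\<alpha>..\<alpha> * (1 + \<gamma>)}}
          else {(\<alpha> * (1 + \<gamma> + \<gamma> * ln (norm z / \<kappa> x))) *\<^sub>R (z /\<^sub>R norm z)})" if "z \<noteq> 0" for z
    \<comment> \<open>The image of each branch of the half-line formula under multiplication by the
      unit vector.\<close>
    unfolding radial[OF that] using that by (auto simp: d phi_subgradients_def)
  have origin: "?D 0 = {\<xi>. norm \<xi> \<le> \<alpha>}"
    unfolding Phi_def using pos by (intro subdifferential_radial_zero) (simp_all add: d phi_subgradients_def)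
  show ?case
    unfolding F Let_def
  proof (intro conjI allI impI)
    show "convex_on {0..} (phi \<alpha> \<kappa> \<gamma> x)" by (fact conv)
    show "phi_conj \<alpha> \<kappa> \<gamma> x s = ereal (phi_conj_fun \<alpha> (\<kappa> x) \<gamma> s)" for s
      using pos by (rule phi_conj_eq)
    show "isCont (phi_conj_fun \<alpha> (\<kappa> x) \<gamma>) \<alpha>" "isCont (phi_conj_fun \<alpha> (\<kappa> x) \<gamma>) (\<alpha> * (1 + \<gamma>))"
      using pos by (rule isCont_phi_conj_fun)+
    show "?D z = (\<lambda>l. l *\<^sub>R (z /\<^sub>R norm z)) ` ?d (norm z)" if "z \<noteq> 0" for z
      using that by (rule radial)
  qed (erule cases | simp only: d origin phi_conj_subdifferential[where \<kappa> = \<kappa> and x = x, OF pos]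
      phi_subgradients_def phi_conj_subgradients_def)+
qed

end
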